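(* Let $\kappa>0$ and $n\ge 1$. Let ${\bf x}=(x_1,\dots,x_{2n})$ and ${\bf u}=(u_1,\dots,u_{n-1})$ be variables, and let $$\phi({\bf x},{\bf u})=\prod_{\substack{1\leq i< n\\1\leq j<2n}}(u_i-x_j)^{-\frac 4\kappa}\prod_{1\leq i<n}(u_i-x_{2n})^{\frac{12}\kappa-2}\prod_{1\leq i_1<i_2<n}(u_{i_2}-u_{i_1})^{\frac 8\kappa}\prod_{1\leq j_1<j_2<2n}(x_{j_2}-x_{j_1})^{\frac 2\kappa}\prod_{1\leq j<2n}(x_{2n}-x_{j})^{1-\frac 6\kappa}.$$ For $1\le k\le 2n$ let $\mathcal{L}_k$ be the differential operator in the $x$ variables $$\mathcal{L}_k=\frac\kappa 2\frac{\partial^2}{\partial x_k^2}+\sum_{l\neq k}\frac{2}{x_l-x_k}\frac{\partial}{\partial x_l}+\frac{\kappa-6}\kappa\sum_{l\neq k}\frac 1{(x_l-x_k)^2},$$ where $l$ ranges over $\{1,\dots,2n\}\setminus\{k\}$. Then: (i) If $1\leq k<2n$, then $$\mathcal{L}_k\phi=-\sum_{1\leq i<n}\frac{\partial}{\partial u_i}\left(\frac{2\phi}{u_i-x_k}\right).$$ (ii) Moreover, $$\mathcal{L}_{2n}\phi=-\sum_{1\leq i<n}\frac{\partial}{\partial u_i}\left(\left(\frac 2{u_i-x_{2n}}+\frac{\kappa-8}{u_i-x_{2n}}\prod_{1\leq j<2n}\frac{u_i-x_j}{x_{2n}-x_j}\prod_{1\leq j<n,\,j\neq i}\left(\frac{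x_{2n}-u_j}{u_i-u_j}\right)^2\right)\phi\right).$$
   Context: The function $\phi$ is a product of (in general non-integer) powers of differences of the variables. The identities are understood at any point where the variables $x_1,\dots,x_{2n},u_1,\dots,u_{n-1}$ are pairwise distinct (complex numbers), for an arbitrary local holomorphic determination of $\phi$ near that point (i.e. an arbitrary choice of branch for each power). Empty sums are $0$ and empty products are $1$. *)

theory Defs
  imports "HOL-Analysis.Analysis"
begin

text \<open>
  A point with coordinates \<open>x\<^sub>1, \<dots>, x\<^sub>m\<close> is a function \<open>nat \<Rightarrow> complex\<close> of which only
  the values at \<open>1, \<dots>, m\<close> are used.
\<close>

definition log_branch_at :: "complex \<Rightarrow> (complex \<Rightarrow> complex) \<Rightarrow> bool" where
  "log_branch_at w L \<longleftrightarrow>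
     (\<exists>S. open S \<and> w \<in> S \<and> L holomorphic_on S \<and> (\<forall>z\<in>S. exp (L z) = z))"

text \<open>The branch of \<open>z\<^sup>a\<close> given by the branch \<open>L\<close> of the logarithm.\<close>

definition bpow :: "(complex \<Rightarrow> complex) \<Rightarrow> real \<Rightarrow> complex \<Rightarrow> complex" where
  "bpow L a z = exp (of_real a * L z)"

text \<open>
  Each power occurring in \<open>\<phi>\<close> has its own branch: \<open>Lux i j\<close> is used for \<open>u\<^sub>i - x\<^sub>j\<close>,
  \<open>Luu i\<^sub>1 i\<^sub>2\<close> for \<open>u\<^bsub>i\<^sub>2\<^esub> - u\<^bsub>i\<^sub>1\<^esub>\<close>, and \<open>Lxx j\<^sub>1 j\<^sub>2\<close> for \<open>x\<^bsub>j\<^sub>2\<^esub> - x\<^bsub>j\<^sub>1\<^esub>\<close>.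
\<close>

definition phi ::
  "real \<Rightarrow> nat \<Rightarrow> (nat \<Rightarrow> nat \<Rightarrow> complex \<Rightarrow> complex) \<Rightarrow> (nat \<Rightarrow> nat \<Rightarrow> complex \<Rightarrow> complex) \<Rightarrow>
   (nat \<Rightarrow> nat \<Rightarrow> complex \<Rightarrow> complex) \<Rightarrow> (nat \<Rightarrow> complex) \<Rightarrow> (nat \<Rightarrow> complex) \<Rightarrow> complex" where
  "phi \<kappa> n Lux Luu Lxx x u =
     (\<Prod>i\<in>{1..<n}. \<Prod>j\<in>{1..<2*n}. bpow (Lux i j) (- 4 / \<kappa>) (u i - x j)) *
     (\<Prod>i\<in>{1..<n}. bpow (Lux i (2*n)) (12 / \<kappa> - 2) (u i - x (2*n))) *
     (\<Prod>i2\<in>{1..<n}. \<Prod>i1\<in>{1..<i2}. bpow (Luu i1 i2) (8 / \<kappa>) (u i2 - u i1)) *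
     (\<Prod>j2\<in>{1..<2*n}. \<Prod>j1\<in>{1..<j2}. bpow (Lxx j1 j2) (2 / \<kappa>) (x j2 - x j1)) *
     (\<Prod>j\<in>{1..<2*n}. bpow (Lxx j (2*n)) (1 - 6 / \<kappa>) (x (2*n) - x j))"

definition partial :: "nat \<Rightarrow> ((nat \<Rightarrow> complex) \<Rightarrow> complex) \<Rightarrow> (nat \<Rightarrow> complex) \<Rightarrow> complex" where
  "partial l f x = deriv (\<lambda>z. f (x(l := z))) (x l)"

definition Lop ::
  "real \<Rightarrow> nat \<Rightarrow> nat \<Rightarrow> ((nat \<Rightarrow> complex) \<Rightarrow> complex) \<Rightarrow> (nat \<Rightarrow> complex) \<Rightarrow> complex" where
  "Lop \<kappa> n k f x =
     of_real (\<kappa> / 2) * partial k (partial k f) x +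
     (\<Sum>l\<in>{1..2*n} - {k}. 2 / (x l - x k) * partial l f x) +
     of_real ((\<kappa> - 6) / \<kappa>) * (\<Sum>l\<in>{1..2*n} - {k}. 1 / (x l - x k)\<^sup>2) * f x"

end

theory Submission
  imports Defs "HOL-Complex_Analysis.Residue_Theorem"
begin

text \<open>
  List all the points as \<open>y = (x\<^sub>1, \<dots>, x\<^bsub>2n\<^esub>, u\<^sub>1, \<dots>, u\<^bsub>n-1\<^esub>)\<close> and give charge \<open>1\<close> to \<open>x\<^sub>j\<close> for \<open>j < 2n\<close>,
  \<open>(\<kappa> - 6) / 2\<close> to \<open>x\<^bsub>2n\<^esub>\<close> and \<open>-2\<close> to \<open>u\<^sub>i\<close>; then \<open>\<phi>\<close> is the Coulomb gas product of the powers
  \<open>(y\<^sub>b - y\<^sub>a)\<close> to the \<open>2 c\<^sub>a c\<^sub>b / \<kappa>\<close>. In \<open>\<L>\<^sub>k \<phi> / \<phi>\<close>, after the divergence of \<open>2 \<phi> / (u\<^sub>i - x\<^sub>k)\<close> is added,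
  the drift terms symmetrise to a double sum that cancels the cross terms of the second derivative
  up to the factor \<open>c\<^sub>k\<^sup>2 - 1\<close>. For \<open>c\<^sub>k = 1\<close> everything cancels. For \<open>k = 2n\<close> what remains is
  \<open>(\<kappa> - 8) (\<kappa> - 4) / \<kappa>\<close> times the residue at \<open>x\<^bsub>2n\<^esub>\<close> of a rational function whose other residues, at
  the \<open>u\<^sub>i\<close>, produce the second divergence term; the residues add up to zero.
\<close>

section \<open>Calculus with logarithmic derivatives\<close>

text \<open>Derivatives are kept in the form value times logarithmic derivative: these factors add
  up under products, and no logarithm of the whole product has to be chosen.\<close>

lemma has_field_derivative_mult_log:
  fixes f g :: "complex \<Rightarrow> complex"
  assumes "(f has_field_derivative f z * D) (at z)" "(g has_field_derivative g z * E) (at z)"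
  shows "((\<lambda>w. f w * g w) has_field_derivative f z * g z * (D + E)) (at z)"
  by (rule DERIV_cong[OF DERIV_mult[OF assms]]) (simp add: algebra_simps)

lemma has_field_derivative_prod_log:
  fixes f :: "'i \<Rightarrow> complex \<Rightarrow> complex"
  assumes "\<And>i. i \<in> I \<Longrightarrow> (f i has_field_derivative f i z * D i) (at z)"
  shows "((\<lambda>w. \<Prod>i\<in>I. f i w) has_field_derivative (\<Prod>i\<in>I. f i z) * (\<Sum>i\<in>I. D i)) (at z)"
  using assms
proof (induction I rule: infinite_finite_induct)
  case (insert i I)
  then have "((\<lambda>w. f i w * (\<Prod>i\<in>I. f i w)) has_field_derivative
          f i z * (\<Prod>i\<in>I. f i z) * (D i + (\<Sum>i\<in>I. D i))) (at z)"
    by (intro has_field_derivative_mult_log) auto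
  then show ?case using insert.hyps by simp
qed auto

text \<open>From \<open>f' = f * D\<close> follows \<open>f'' = f * D^2 + f * D'\<close>. The first
  formula is required on a neighbourhood because it is differentiated again, the second only at the
  point.\<close>

lemma deriv_deriv_log:
  fixes f D :: "complex \<Rightarrow> complex"
  assumes "\<forall>\<^sub>F w in nhds z. (f has_field_derivative f w * D w) (at w)"
    and "(D has_field_derivative D') (at z)"
  shows "deriv (deriv f) z = f z * ((D z)\<^sup>2 + D')"
proof -
  have f: "(f has_field_derivative f z * D z) (at z)"
    using assms(1) by (rule eventually_nhds_x_imp_x)
  have "\<forall>\<^sub>F w in nhds z. deriv f w = f w * D w"
    using assms(1) by eventually_elim (rule DERIV_imp_deriv)
  moreover have "((\<lambda>w. f w * D w) has_field_derivative f z * D z * D z + D' * f z) (at z)"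
    using f assms(2) by (rule DERIV_mult)
  ultimately show ?thesis
    by (simp add: deriv_cong_ev DERIV_imp_deriv power2_eq_square algebra_simps)
qed

section \<open>Residues of a rational function\<close>

text \<open>Integrate over a large circle around all of \<open>S\<close>. The decay bounds the
  integrand by \<open>e / R\<close> there, so the integral has norm at most
  \<open>2 * pi * e\<close> for every \<open>e > 0\<close>, while the residue theorem evaluates it
  as \<open>2 * pi * \<i>\<close> times the sum.\<close>

lemma sum_residue_eq_0:
  assumes "finite S" and holo: "f holomorphic_on - S"
    and decay: "((\<lambda>w. w * f w) \<longlongrightarrow> 0) at_infinity"
  shows "(\<Sum>s\<in>S. residue f s) = 0"
proof -
  have "norm (\<Sum>s\<in>S. residue f s) \<le> e" if "e > 0" for e
  proof -
    have "\<forall>\<^sub>F w in at_infinity. norm (w * f w) < e"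
      using tendstoD[OF decay \<open>e > 0\<close>] by simp
    then obtain b where b: "\<And>w. norm w \<ge> b \<Longrightarrow> norm (w * f w) < e"
      by (auto simp: eventually_at_infinity)
    obtain M where M: "\<And>s. s \<in> S \<Longrightarrow> norm s \<le> M"
      using finite_imp_bounded[OF \<open>finite S\<close>] unfolding bounded_iff by blast
    \<comment> \<open>The summand 1 puts every point of \<open>S\<close> strictly inside the circle,
      so all winding numbers are 1.\<close>
    define R where "R = max 0 (max b M) + 1"
    have R: "R > 0" "R \<ge> b" "\<And>s. s \<in> S \<Longrightarrow> norm s < R"
      using M by (force simp: R_def)+
    have disj: "path_image (circlepath 0 R) \<subseteq> UNIV - S"
      using R by (auto simp: less_le)
    have f: "f holomorphic_on UNIV - S" using holo by (simp add: Compl_eq_Diff_UNIV)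
    have "contour_integral (circlepath 0 R) f =
            2 * pi * \<i> * (\<Sum>s\<in>S. winding_number (circlepath 0 R) s * residue f s)"
      by (rule Residue_theorem[of UNIV S]) (use \<open>finite S\<close> f disj in auto)
    also have "\<dots> = 2 * pi * \<i> * (\<Sum>s\<in>S. residue f s)"
      using R(3) by (simp add: winding_number_circlepath)
    finally have eq: "contour_integral (circlepath 0 R) f = 2 * pi * \<i> * (\<Sum>s\<in>S. residue f s)" .
    have "continuous_on (path_image (circlepath 0 R)) f"
      using holomorphic_on_imp_continuous_on[OF f] disj continuous_on_subset by blast
    then have "(f has_contour_integral contour_integral (circlepath 0 R) f) (circlepath 0 R)"
      by (intro has_contour_integral_integral contour_integrable_continuous_circlepath)
    then have "norm (contour_integral (circlepath 0 R) f) \<le> e / R * (2 * pi * R)"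
    proof (rule has_contour_integral_bound_circlepath)
      show "norm (f w) \<le> e / R" if "norm (w - 0) = R" for w
        using b[of w] that R by (simp add: norm_mult field_simps)
    qed (use R that in auto)
    then show ?thesis
      using R(1) unfolding eq by (simp add: norm_mult)
  qed
  then have "norm (\<Sum>s\<in>S. residue f s) \<le> 0"
    by (rule field_le_epsilon[of _ 0, simplified])
  then show ?thesis by simp
qed

text \<open>
  The residues of \<open>\<Prod>j (1 - w / z j) * \<Prod>i (v i / (w - v i))\<^sup>2 / w\<^sup>3\<close> at the double poles \<open>v i\<close> are
  the summands on the left, the residue at the triple pole \<open>0\<close> is minus the right-hand side, and
  the degrees make the residue at infinity vanish.
\<close>

lemma residue_identity:
  fixes v :: "'i \<Rightarrow> complex" and z :: "'j \<Rightarrow> complex"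
  assumes fin: "finite J" "finite X" and card: "card X = 2 * card J + 1"
    and inj: "inj_on v J" and v0: "\<And>i. i \<in> J \<Longrightarrow> v i \<noteq> 0" and z0: "\<And>j. j \<in> X \<Longrightarrow> z j \<noteq> 0"
    and vz: "\<And>i j. i \<in> J \<Longrightarrow> j \<in> X \<Longrightarrow> v i \<noteq> z j"
  shows "(\<Sum>i\<in>J. 1 / v i * (\<Prod>j\<in>X. (z j - v i) / z j) * (\<Prod>j\<in>J-{i}. (v j / (v i - v j))\<^sup>2) *
            ((\<Sum>j\<in>X. 1 / (v i - z j)) - 3 / v i - 2 * (\<Sum>j\<in>J-{i}. 1 / (v i - v j)))) =
         - (((\<Sum>j\<in>X. 1 / z j) - 2 * (\<Sum>i\<in>J. 1 / v i))\<^sup>2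
             - (\<Sum>j\<in>X. 1 / (z j)\<^sup>2) + 2 * (\<Sum>i\<in>J. 1 / (v i)\<^sup>2)) / 2"
    (is "(\<Sum>i\<in>J. ?G i) = ?R")
proof -
  \<comment> \<open>The index set is a parameter: \<open>P J\<close> serves at the pole 0, where it
    is normalised to the value 1, and \<open>P (J - {i})\<close> serves at \<open>v i\<close>, whose
    own factor has been taken out. \<open>D K\<close> is the logarithmic derivative of
    \<open>P K\<close>.\<close>
  define P where "P K w = (\<Prod>j\<in>X. (z j - w) / z j) * (\<Prod>i\<in>K. (v i / (w - v i))\<^sup>2)" for K w
  define D where "D K w = (\<Sum>j\<in>X. 1 / (w - z j)) - 2 * (\<Sum>i\<in>K. 1 / (w - v i))" for K w
  define F where "F w = P J w / w ^ 3" for w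
  have holP: "P K holomorphic_on - (v ` K)" if "K \<subseteq> J" for K
    unfolding P_def using z0 that by (auto intro!: holomorphic_intros)
  have DP: "(P K has_field_derivative P K w * D K w) (at w)"
    if K: "K \<subseteq> J" and w: "w \<notin> v ` K" "w \<notin> z ` X" for K w
  proof -
    have 1: "((\<lambda>w. (z j - w) / z j) has_field_derivative (z j - w) / z j * (1 / (w - z j))) (at w)"
      if "j \<in> X" for j
    proof -
      have "w \<noteq> z j" using w(2) that by auto
      then show ?thesis
        using z0[OF that] by (auto intro!: derivative_eq_intros simp: field_simps)
    qed
    have 2: "((\<lambda>w. (v i / (w - v i))\<^sup>2) has_field_derivative (v i / (w - v i))\<^sup>2 * (- 2 / (w - v i))) (at w)"
      if "i \<in> K" for i
    proof -
      have "w \<noteq> v i" using w(1) that by auto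
      then have "w - v i \<noteq> 0" by simp
      then show ?thesis
        by (auto intro!: derivative_eq_intros simp: power2_eq_square divide_simps)
    qed
    have "(P K has_field_derivative
        (\<Prod>j\<in>X. (z j - w) / z j) * (\<Prod>i\<in>K. (v i / (w - v i))\<^sup>2) *
        ((\<Sum>j\<in>X. 1 / (w - z j)) + (\<Sum>i\<in>K. - 2 / (w - v i)))) (at w)"
      unfolding P_def
      by (intro has_field_derivative_mult_log has_field_derivative_prod_log 1 2)
    then show ?thesis
      by (simp add: P_def D_def sum_distrib_left sum_negf)
  qed
  have res0: "residue F 0 = - ?R"
  proof -
    have opn: "open (- (v ` J))" using fin by (simp add: finite_imp_closed open_Compl)
    have ne: "0 \<in> - (v ` J)" using v0 by force
    \<comment> \<open>At the triple pole the residue is the second Taylor coefficient of the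
      numerator.\<close>
    have "residue F 0 = deriv (deriv (P J)) 0 / 2"
      unfolding F_def using residue_holomorphic_over_power'[OF opn ne holP, where n = 2]
      by (simp add: eval_nat_numeral)
    also have "deriv (deriv (P J)) 0 = P J 0 * ((D J 0)\<^sup>2 + ((\<Sum>j\<in>X. - 1 / (z j)\<^sup>2) - 2 * (\<Sum>i\<in>J. - 1 / (v i)\<^sup>2)))"
      proof (rule deriv_deriv_log)
      have "open (- (v ` J \<union> z ` X))" using fin by (intro open_Compl finite_imp_closed) auto
      moreover have "0 \<in> - (v ` J \<union> z ` X)" using v0 z0 by force
      ultimately have "\<forall>\<^sub>F w in nhds 0. w \<in> - (v ` J \<union> z ` X)"
        by (rule eventually_nhds_in_open)
      then show "\<forall>\<^sub>F w in nhds 0. (P J has_field_derivative P J w * D J w) (at w)"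
        by eventually_elim (auto intro!: DP)
      show "(D J has_field_derivative (\<Sum>j\<in>X. - 1 / (z j)\<^sup>2) - 2 * (\<Sum>i\<in>J. - 1 / (v i)\<^sup>2)) (at 0)"
        unfolding D_def using v0 z0
        by (auto intro!: derivative_eq_intros sum.cong simp: power2_eq_square)
    qed
    also have "P J 0 = 1" using v0 z0 by (simp add: P_def)
    also have "D J 0 = - ((\<Sum>j\<in>X. 1 / z j) - 2 * (\<Sum>i\<in>J. 1 / v i))"
      by (simp add: D_def sum_negf)
    finally show ?thesis by (simp add: sum_negf power2_eq_square field_simps)
  qed
  have resv: "residue F (v i) = ?G i" if i: "i \<in> J" for i
  proof -
    \<comment> \<open>Near the double pole, \<open>F w = h w / (w - v i)^2\<close>, so the residue
      is \<open>h'\<close> at \<open>v i\<close>; the factor \<open>w ^ 3\<close> in the denominator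
      of \<open>h\<close> accounts for the term \<open>- 3 / v i\<close>.\<close>
    define h where "h w = (v i)\<^sup>2 * P (J - {i}) w / w ^ 3" for w
    let ?A = "- insert 0 (v ` (J - {i}))"
    have opn: "open ?A" using fin by (intro open_Compl finite_imp_closed) auto
    have vi: "v i \<in> ?A" using v0[OF i] inj i by (auto simp: inj_on_def)
    have F: "F = (\<lambda>w. h w / (w - v i) ^ Suc 1)"
      unfolding F_def h_def P_def using i fin
      by (subst prod.remove[of J i]) (auto simp: fun_eq_iff power2_eq_square mult_ac)
    have "h holomorphic_on ?A"
      unfolding h_def
      by (intro holomorphic_intros holomorphic_on_subset[OF holP]) auto
    then have "residue F (v i) = (deriv ^^ 1) h (v i) / fact 1"
      unfolding F by (rule residue_holomorphic_over_power[OF opn vi])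
    also have "\<dots> = deriv h (v i)" by simp
    also have "\<dots> = h (v i) * (D (J - {i}) (v i) - 3 / v i)"
    proof (rule DERIV_imp_deriv)
      have "(P (J-{i}) has_field_derivative P (J-{i}) (v i) * D (J-{i}) (v i)) (at (v i))"
        using vi vz[OF i] by (intro DP) auto
      then show "(h has_field_derivative h (v i) * (D (J - {i}) (v i) - 3 / v i)) (at (v i))"
        unfolding h_def using v0[OF i]
        by (auto intro!: derivative_eq_intros simp: divide_simps power2_eq_square eval_nat_numeral)
          (simp_all add: algebra_simps)
    qed
    also have "h (v i) = 1 / v i * (\<Prod>j\<in>X. (z j - v i) / z j) * (\<Prod>j\<in>J-{i}. (v j / (v i - v j))\<^sup>2)"
      using v0[OF i] by (simp add: h_def P_def power2_eq_square power3_eq_cube)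
    finally show ?thesis by (simp add: D_def algebra_simps)
  qed
  have "(\<Sum>s\<in>insert 0 (v ` J). residue F s) = 0"
  proof (rule sum_residue_eq_0)
    show "F holomorphic_on - insert 0 (v ` J)"
      unfolding F_def by (intro holomorphic_intros holomorphic_on_subset[OF holP]) auto
    \<comment> \<open>With \<open>1 / w\<close> as variable, the hypothesis on \<open>card X\<close>
      leaves exactly \<open>w * F w = C w / w\<close>: the powers \<open>2 * card J + 1\<close> and
      \<open>- 2 * card J\<close> combine with \<open>w / w ^ 3\<close>. As \<open>C\<close> has a
      finite limit at infinity, the product tends to 0.\<close>
    define C where "C w = (\<Prod>j\<in>X. inverse w - inverse (z j)) * (\<Prod>i\<in>J. (v i / (1 - v i * inverse w))\<^sup>2)" for w
    have inf: "((inverse :: complex \<Rightarrow> complex) \<longlongrightarrow> 0) at_infinity" by (rule tendsto_inverse_0)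
    have "((\<lambda>w. inverse w * C w) \<longlongrightarrow> 0 * ((\<Prod>j\<in>X. 0 - inverse (z j)) * (\<Prod>i\<in>J. (v i / (1 - v i * 0))\<^sup>2))) at_infinity"
      unfolding C_def by (intro tendsto_intros inf) auto
    moreover have "\<forall>\<^sub>F w in at_infinity. inverse w * C w = w * F w"
    proof -
      have ne: "\<forall>\<^sub>F w in at_infinity. w \<noteq> (0::complex)"
        by (auto simp: eventually_at_infinity intro!: exI[of _ 1])
      then show ?thesis
      proof eventually_elim
        case (elim w)
        have "(\<Prod>j\<in>X. (z j - w) / z j) = (\<Prod>j\<in>X. w * (inverse w - inverse (z j)))"
          using z0 elim by (intro prod.cong) (auto simp: field_simps)
        also have "\<dots> = w ^ (2 * card J + 1) * (\<Prod>j\<in>X. inverse w - inverse (z j))"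
          by (simp add: prod.distrib card)
        finally have 1: "(\<Prod>j\<in>X. (z j - w) / z j) = w ^ (2 * card J + 1) * (\<Prod>j\<in>X. inverse w - inverse (z j))" .
        have "(\<Prod>i\<in>J. (v i / (w - v i))\<^sup>2) = (\<Prod>i\<in>J. inverse (w\<^sup>2) * (v i / (1 - v i * inverse w))\<^sup>2)"
        proof (intro prod.cong refl)
          fix i
          have "w - v i = w * (1 - v i * inverse w)" using elim by (simp add: field_simps)
          then show "(v i / (w - v i))\<^sup>2 = inverse (w\<^sup>2) * (v i / (1 - v i * inverse w))\<^sup>2"
            using elim by (simp add: power_mult_distrib power_divide field_simps)
        qed
        also have "\<dots> = inverse (w ^ (2 * card J)) * (\<Prod>i\<in>J. (v i / (1 - v i * inverse w))\<^sup>2)"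
          by (simp add: prod.distrib power_inverse power_mult)
        finally have 2: "(\<Prod>i\<in>J. (v i / (w - v i))\<^sup>2) = inverse (w ^ (2 * card J)) * (\<Prod>i\<in>J. (v i / (1 - v i * inverse w))\<^sup>2)" .
        show ?case
          unfolding F_def P_def C_def 1 2 using elim
          by (simp add: power3_eq_cube field_simps)
      qed
    qed
    ultimately show "((\<lambda>w. w * F w) \<longlongrightarrow> 0) at_infinity"
      by (simp add: tendsto_cong)
  qed (use fin in auto)
  also have "(\<Sum>s\<in>insert 0 (v ` J). residue F s) = residue F 0 + (\<Sum>i\<in>J. residue F (v i))"
    using fin v0 inj by (subst sum.insert) (auto simp: sum.reindex)
  finally show ?thesis
    using res0 resv by (simp add: add_eq_0_iff2)
qed

section \<open>Branches of logarithms and powers\<close>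

lemma eventually_log_branch_at:
  assumes "log_branch_at w L"
  shows "\<forall>\<^sub>F w' in nhds w. log_branch_at w' L"
  using assms unfolding log_branch_at_def eventually_nhds by blast

lemma log_branch_at_nonzero: "log_branch_at w L \<Longrightarrow> w \<noteq> 0"
  unfolding log_branch_at_def by (metis exp_not_eq_zero)

text \<open>Differentiating \<open>exp (L z) = z\<close> gives \<open>w * L' = 1\<close>, whichever
  branch is chosen.\<close>

lemma has_field_derivative_log_branch:
  assumes "log_branch_at w L"
  shows "(L has_field_derivative 1 / w) (at w)"
proof -
  obtain S where S: "open S" "w \<in> S" "L holomorphic_on S" "\<And>z. z \<in> S \<Longrightarrow> exp (L z) = z"
    using assms unfolding log_branch_at_def by blast
  have L: "(L has_field_derivative deriv L w) (at w)"
    using S by (intro holomorphic_derivI)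
  have "((\<lambda>z. exp (L z)) has_field_derivative exp (L w) * deriv L w) (at w)"
    using L by (rule DERIV_fun_exp)
  moreover have "((\<lambda>z. exp (L z)) has_field_derivative 1) (at w)"
    using S by (intro has_field_derivative_transform_within_open[OF DERIV_ident, of S]) auto
  ultimately have "w * deriv L w = 1"
    using S(2,4) DERIV_unique by fastforce
  then have "deriv L w = 1 / w"
    using log_branch_at_nonzero[OF assms] by (simp add: field_simps)
  then show ?thesis using L by simp
qed

lemma has_field_derivative_bpow:
  assumes "log_branch_at (f z) L" and "(f has_field_derivative f') (at z)"
  shows "((\<lambda>w. bpow L a (f w)) has_field_derivative
           bpow L a (f z) * (of_real a * f' / f z)) (at z)"
proof -
  have "((\<lambda>w. L (f w)) has_field_derivative 1 / f z * f') (at z)"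
    using has_field_derivative_log_branch[OF assms(1)] assms(2) by (rule DERIV_chain2)
  then have "((\<lambda>w. of_real a * L (f w)) has_field_derivative of_real a * (1 / f z * f')) (at z)"
    by (rule DERIV_cmult)
  then show ?thesis
    unfolding bpow_def by (auto dest: DERIV_fun_exp)
qed

section \<open>Coulomb gas products and their derivatives\<close>

definition coulomb ::
  "nat \<Rightarrow> (nat \<Rightarrow> nat \<Rightarrow> real) \<Rightarrow> (nat \<Rightarrow> nat \<Rightarrow> complex \<Rightarrow> complex) \<Rightarrow> (nat \<Rightarrow> complex) \<Rightarrow> complex"
  where "coulomb m p L y = (\<Prod>b\<in>{1..<m}. \<Prod>a\<in>{1..<b}. bpow (L a b) (p a b) (y b - y a))"

definition branches :: "nat \<Rightarrow> (nat \<Rightarrow> nat \<Rightarrow> complex \<Rightarrow> complex) \<Rightarrow> (nat \<Rightarrow> complex) \<Rightarrow> bool"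
  where "branches m L y \<longleftrightarrow> (\<forall>b\<in>{1..<m}. \<forall>a\<in>{1..<b}. log_branch_at (y b - y a) (L a b))"

text \<open>For symmetric exponents this is the logarithmic derivative of \<open>coulomb\<close> in
  the \<open>k\<close>-th coordinate.\<close>

definition logd :: "nat \<Rightarrow> (nat \<Rightarrow> nat \<Rightarrow> real) \<Rightarrow> nat \<Rightarrow> (nat \<Rightarrow> complex) \<Rightarrow> complex"
  where "logd m p k y = (\<Sum>a\<in>{1..<m}-{k}. of_real (p k a) / (y k - y a))"

text \<open>A logarithm can only exist at a nonzero difference, since \<open>exp\<close> has no
  zeros; distinctness of the points is thus contained in \<open>branches\<close>.\<close>

lemma branches_inj_on: "branches m L y \<Longrightarrow> inj_on y {1..<m}"
proof (intro inj_onI)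
  fix a b assume *: "branches m L y" "a \<in> {1..<m}" "b \<in> {1..<m}" "y a = y b"
  have "\<not> a' < b'" if "a' \<in> {1..<m}" "b' \<in> {1..<m}" "y a' = y b'" for a' b'
    using *(1) that log_branch_at_nonzero unfolding branches_def by fastforce
  then show "a = b" using * by (metis linorder_neqE_nat)
qed

text \<open>Having a branch is an open condition and there are finitely many pairs. This lets the
  first derivative formula be used on a neighbourhood, as second derivatives require.\<close>

lemma eventually_branches:
  assumes "branches m L y"
  shows "\<forall>\<^sub>F z in nhds (y k). branches m L (y(k := z))"
  unfolding branches_def
proof (intro eventually_ball_finite ballI)
  fix b a assume ab: "b \<in> {1..<m}" "a \<in> {1..<b}"
  let ?d = "\<lambda>z. (y(k := z)) b - (y(k := z)) a"
  have *: "log_branch_at (?d (y k)) (L a b)"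
    using assms ab by (simp add: branches_def)
  have "isCont ?d (y k)"
    by (cases "b = k"; cases "a = k") auto
  then have "filterlim ?d (nhds (?d (y k))) (nhds (y k))"
    using isCont_def tendsto_at_iff_tendsto_nhds by blast
  then show "\<forall>\<^sub>F z in nhds (y k). log_branch_at (?d z) (L a b)"
    using eventually_compose_filterlim[OF eventually_log_branch_at[OF *]] by blast
qed auto

lemma has_field_derivative_coulomb:
  assumes br: "branches m L y" and k: "k \<in> {1..<m}" and sym: "\<And>a b. p a b = p b a"
  shows "((\<lambda>z. coulomb m p L (y(k := z))) has_field_derivative
           coulomb m p L y * logd m p k y) (at (y k))"
proof -
  \<comment> \<open>\<open>e b\<close> is the derivative of the coordinate \<open>b\<close> when
    only \<open>y k\<close> moves, and \<open>E a b\<close> is the resulting contribution of a pair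
    to the logarithmic derivative.\<close>
  define e :: "nat \<Rightarrow> complex" where "e b = (if b = k then 1 else 0)" for b
  define E where "E a b = of_real (p a b) * (e b - e a) / (y b - y a)" for a b
  have d: "((\<lambda>z. (y(k := z)) b) has_field_derivative e b) (at (y k))" for b
    by (auto simp: e_def)
  have "((\<lambda>z. coulomb m p L (y(k := z))) has_field_derivative
          (\<Prod>b\<in>{1..<m}. \<Prod>a\<in>{1..<b}. bpow (L a b) (p a b) ((y(k := y k)) b - (y(k := y k)) a)) *
          (\<Sum>b\<in>{1..<m}. \<Sum>a\<in>{1..<b}. of_real (p a b) * (e b - e a) / ((y(k := y k)) b - (y(k := y k)) a)))
         (at (y k))"
    unfolding coulomb_def
    by (intro has_field_derivative_prod_log has_field_derivative_bpow DERIV_diff d)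
      (use br in \<open>auto simp: branches_def\<close>)
  then have deriv: "((\<lambda>z. coulomb m p L (y(k := z))) has_field_derivative
          coulomb m p L y * (\<Sum>b\<in>{1..<m}. \<Sum>a\<in>{1..<b}. E a b)) (at (y k))"
    by (simp add: coulomb_def E_def)
  \<comment> \<open>Only pairs containing \<open>k\<close> contribute: for \<open>b = k\<close> the
    whole inner sum, for \<open>b > k\<close> the single term \<open>a = k\<close>. Symmetry of
    \<open>p\<close> gives both the same shape.\<close>
  have "(\<Sum>b\<in>{1..<m}. \<Sum>a\<in>{1..<b}. E a b) =
      (\<Sum>b\<in>{1..<m}. (if b = k then \<Sum>a\<in>{1..<k}. of_real (p k a) / (y k - y a) else 0) +
         (if b \<in> {k<..<m} then of_real (p k b) / (y k - y b) else 0))"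
  proof (rule sum.cong)
    fix b assume b: "b \<in> {1..<m}"
    consider "b = k" | "b < k" | "k < b" by linarith
    then show "(\<Sum>a\<in>{1..<b}. E a b) = (if b = k then \<Sum>a\<in>{1..<k}. of_real (p k a) / (y k - y a) else 0) +
         (if b \<in> {k<..<m} then of_real (p k b) / (y k - y b) else 0)"
    proof cases
      case 1
      then show ?thesis by (auto simp: E_def e_def sym intro!: sum.cong)
    next
      case 2
      then have "(\<Sum>a\<in>{1..<b}. E a b) = 0" by (intro sum.neutral) (auto simp: E_def e_def)
      then show ?thesis using 2 by simp
    next
      case 3
      have "(\<Sum>a\<in>{1..<b}. E a b) = (\<Sum>a\<in>{1..<b}. if a = k then of_real (p k b) / (y k - y b) else 0)"
        using 3 by (intro sum.cong) (auto simp: E_def e_def divide_simps, simp_all add: algebra_simps)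
      then show ?thesis using 3 k b by (simp add: sum.delta)
    qed
  qed simp
  also have "\<dots> = (\<Sum>a\<in>{1..<k}. of_real (p k a) / (y k - y a)) +
                  (\<Sum>b\<in>{k<..<m}. of_real (p k b) / (y k - y b))"
  proof -
    have "(\<Sum>b\<in>{1..<m}. if b \<in> {k<..<m} then of_real (p k b) / (y k - y b) else 0) =
        (\<Sum>b\<in>{k<..<m}. of_real (p k b) / (y k - y b))"
      using k by (intro sum.mono_neutral_cong_right) auto
    then show ?thesis using k by (simp only: sum.distrib) (simp add: sum.delta)
  qed
  also have "\<dots> = logd m p k y"
  proof -
    have "{1..<m} - {k} = {1..<k} \<union> {k<..<m}" using k by auto
    then have "logd m p k y = (\<Sum>a\<in>{1..<k} \<union> {k<..<m}. of_real (p k a) / (y k - y a))"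
      by (simp only: logd_def)
    also have "\<dots> = (\<Sum>a\<in>{1..<k}. of_real (p k a) / (y k - y a)) +
                    (\<Sum>b\<in>{k<..<m}. of_real (p k b) / (y k - y b))"
      by (rule sum.union_disjoint) auto
    finally show ?thesis ..
  qed
  finally show ?thesis
    using deriv by (simp only:)
qed

lemma deriv_deriv_coulomb:
  assumes br: "branches m L y" and k: "k \<in> {1..<m}" and sym: "\<And>a b. p a b = p b a"
  shows "deriv (deriv (\<lambda>z. coulomb m p L (y(k := z)))) (y k) =
           coulomb m p L y * ((logd m p k y)\<^sup>2 - (\<Sum>a\<in>{1..<m}-{k}. of_real (p k a) / (y k - y a)\<^sup>2))"
proof -
  let ?D = "\<lambda>z. logd m p k (y(k := z))"
  have "\<forall>\<^sub>F z in nhds (y k). ((\<lambda>z. coulomb m p L (y(k := z))) has_field_derivative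
                              coulomb m p L (y(k := z)) * ?D z) (at z)"
    using eventually_branches[OF br, of k]
  proof eventually_elim
    case (elim z)
    show ?case using has_field_derivative_coulomb[OF elim k, of p] sym by simp
  qed
  moreover have "(?D has_field_derivative (\<Sum>a\<in>{1..<m}-{k}. - (of_real (p k a) / (y k - y a)\<^sup>2))) (at (y k))"
  proof -
    have "((\<lambda>z. of_real (p k a) / (z - y a)) has_field_derivative - (of_real (p k a) / (y k - y a)\<^sup>2)) (at (y k))"
      if "a \<in> {1..<m} - {k}" for a
    proof -
      have "y k \<noteq> y a" using branches_inj_on[OF br] k that by (auto dest: inj_onD)
      then show ?thesis by (auto intro!: derivative_eq_intros simp: power2_eq_square)
    qed
    then have "((\<lambda>z. \<Sum>a\<in>{1..<m}-{k}. of_real (p k a) / (z - y a)) has_field_derivative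
        (\<Sum>a\<in>{1..<m}-{k}. - (of_real (p k a) / (y k - y a)\<^sup>2))) (at (y k))"
      by (rule DERIV_sum)
    moreover have "?D = (\<lambda>z. \<Sum>a\<in>{1..<m}-{k}. of_real (p k a) / (z - y a))"
      by (auto simp: logd_def intro!: ext sum.cong)
    ultimately show ?thesis by simp
  qed
  ultimately have "deriv (deriv (\<lambda>z. coulomb m p L (y(k := z)))) (y k) =
      coulomb m p L (y(k := y k)) * ((?D (y k))\<^sup>2 + (\<Sum>a\<in>{1..<m}-{k}. - (of_real (p k a) / (y k - y a)\<^sup>2)))"
    by (rule deriv_deriv_log)
  then show ?thesis by (simp only: fun_upd_triv sum_negf diff_conv_add_uminus)
qed

text \<open>
  The terms of \<open>(\<Sum>a. c a * r a)\<^sup>2\<close> with distinct indices cancel against the symmetrised double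
  sum, since \<open>(r a - r b) / (z a - z b) = - r a * r b\<close> for \<open>r = 1 / z\<close>.
\<close>

lemma coulomb_interaction_sum:
  fixes y :: "nat \<Rightarrow> complex" and c :: "nat \<Rightarrow> real"
  assumes inj: "inj_on y {1..<m}" and k: "k \<in> {1..<m}"
    and p: "\<And>a b. p a b = g * c a * c b"
  defines "r \<equiv> \<lambda>a. 1 / (y a - y k)"
  shows "(\<Sum>a\<in>{1..<m}-{k}. 2 * r a * logd m p a y) =
           of_real g * (2 * of_real (c k) * (\<Sum>a\<in>{1..<m}-{k}. of_real (c a) * (r a)\<^sup>2)
             - ((\<Sum>a\<in>{1..<m}-{k}. of_real (c a) * r a)\<^sup>2 - (\<Sum>a\<in>{1..<m}-{k}. (of_real (c a) * r a)\<^sup>2)))"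
proof -
  define J where "J = {1..<m} - {k}"
  have J: "finite J" "k \<notin> J" "{1..<m} = insert k J" using k by (auto simp: J_def)
  define C where "C a = complex_of_real (c a)" for a
  define G where "G = complex_of_real g"
  have "(\<Sum>a\<in>J. 2 * r a * logd m p a y) =
        (\<Sum>a\<in>J. 2 * G * C k * (C a * (r a)\<^sup>2) + (\<Sum>b\<in>J-{a}. 2 * r a * (G * C a * C b / (y a - y b))))"
  proof (rule sum.cong)
    fix a assume a: "a \<in> J"
    \<comment> \<open>The interaction of \<open>a\<close> with \<open>k\<close> is split off; it
      yields the square terms, and the rest is to be symmetrised.\<close>
    have "{1..<m} - {a} = insert k (J - {a})" using a J by auto
    then have "logd m p a y = G * C a * C k * r a + (\<Sum>b\<in>J-{a}. G * C a * C b / (y a - y b))"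
      unfolding logd_def using J by (simp add: p r_def C_def G_def)
    then show "2 * r a * logd m p a y = 2 * G * C k * (C a * (r a)\<^sup>2) +
        (\<Sum>b\<in>J-{a}. 2 * r a * (G * C a * C b / (y a - y b)))"
      by (simp add: sum_distrib_left algebra_simps power2_eq_square)
  qed simp
  also have "\<dots> = 2 * G * C k * (\<Sum>a\<in>J. C a * (r a)\<^sup>2) +
                  (\<Sum>a\<in>J. \<Sum>b\<in>J-{a}. 2 * r a * (G * C a * C b / (y a - y b)))" (is "_ = _ + ?S")
    by (simp add: sum.distrib sum_distrib_left)
  also have "?S = - G * (\<Sum>a\<in>J. \<Sum>b\<in>J-{a}. (C a * r a) * (C b * r b))"
  proof -
    let ?f = "\<lambda>a b. 2 * r a * (G * C a * C b / (y a - y b))"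
    have swap: "(\<Sum>a\<in>J. \<Sum>b\<in>J-{a}. h a b) = (\<Sum>a\<in>J. \<Sum>b\<in>J-{a}. h b a)" for h :: "nat \<Rightarrow> nat \<Rightarrow> complex"
    proof -
      \<comment> \<open>Filling the diagonal with zeros makes the index set rectangular, so that
        \<open>sum.swap\<close> applies.\<close>
      have eq: "(\<Sum>a\<in>J. \<Sum>b\<in>J-{a}. h a b) = (\<Sum>a\<in>J. \<Sum>b\<in>J. if a = b then 0 else h a b)" for h :: "nat \<Rightarrow> nat \<Rightarrow> complex"
        using J(1) by (intro sum.cong refl sum.mono_neutral_cong_left) auto
      show ?thesis unfolding eq by (subst sum.swap) (auto intro!: sum.cong)
    qed
    have "2 * ?S = (\<Sum>a\<in>J. \<Sum>b\<in>J-{a}. ?f a b + ?f b a)"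
      by (subst mult_2, subst (2) swap) (simp add: sum.distrib)
    also have "\<dots> = (\<Sum>a\<in>J. \<Sum>b\<in>J-{a}. 2 * - G * ((C a * r a) * (C b * r b)))"
    proof (intro sum.cong refl)
      fix a b assume ab: "a \<in> J" "b \<in> J - {a}"
      have "y a \<noteq> y b" "y a \<noteq> y k" "y b \<noteq> y k"
        using inj ab J by (auto simp: inj_on_def)
      then have "r a - r b = - r a * r b * (y a - y b)" and ne: "y a - y b \<noteq> 0"
        by (auto simp: r_def divide_simps)
      then have *: "(r a - r b) / (y a - y b) = - r a * r b" by simp
      have "?f b a = - (2 * r b * (G * C a * C b / (y a - y b)))"
        by (subst minus_diff_eq[symmetric], subst divide_minus_right) (simp add: mult_ac)
      then have "?f a b + ?f b a = 2 * G * C a * C b * ((r a - r b) / (y a - y b))"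
        by (simp add: diff_divide_distrib algebra_simps)
      then show "?f a b + ?f b a = 2 * - G * ((C a * r a) * (C b * r b))"
        unfolding * by simp
    qed
    also have "\<dots> = 2 * (- G * (\<Sum>a\<in>J. \<Sum>b\<in>J-{a}. (C a * r a) * (C b * r b)))"
      by (simp add: sum_distrib_left mult.assoc sum_negf)
    finally show ?thesis by simp
  qed
  also have "(\<Sum>a\<in>J. \<Sum>b\<in>J-{a}. (C a * r a) * (C b * r b)) =
               (\<Sum>a\<in>J. C a * r a)\<^sup>2 - (\<Sum>a\<in>J. (C a * r a)\<^sup>2)"
  proof -
    have "(\<Sum>a\<in>J. C a * r a)\<^sup>2 = (\<Sum>a\<in>J. \<Sum>b\<in>J. (C a * r a) * (C b * r b))"
      by (simp add: power2_eq_square sum_product)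
    also have "\<dots> = (\<Sum>a\<in>J. (C a * r a)\<^sup>2 + (\<Sum>b\<in>J-{a}. (C a * r a) * (C b * r b)))"
      using J(1) by (intro sum.cong refl) (simp add: sum.remove power2_eq_square)
    finally show ?thesis by (simp add: sum.distrib)
  qed
  finally show ?thesis
    unfolding J_def[symmetric] C_def G_def by (simp add: algebra_simps)
qed

section \<open>The function \<open>phi\<close> as a Coulomb gas product\<close>

text \<open>Stated for a general commutative monoid because it is needed for products (in
  \<open>phi\<close>) and for sums (in its logarithmic derivative). The middle index will be that of
  the exceptional point, \<open>2*n\<close>.\<close>

lemma (in comm_monoid_set) atLeastLessThan_split_middle:
  fixes k i :: nat
  assumes "1 \<le> k" "1 \<le> i"
  shows "F g {1..<k + i} = F g {1..<k} \<^bold>* g k \<^bold>* F (\<lambda>a. g (k + a)) {1..<i}"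
proof -
  have "F g {1..<k + i} = F g {1..<k} \<^bold>* F g {k..<k + i}"
    using assms by (intro atLeastLessThan_concat[symmetric]) auto
  also have "F g {k..<k + i} = g k \<^bold>* F g {Suc k..<k + i}"
    using assms by (intro atLeast_Suc_lessThan) auto
  also have "F g {Suc k..<k + i} = F (\<lambda>a. g (k + a)) {1..<i}"
    using atLeastLessThan_shift_bounds[of g 1 k i] by (simp add: add.commute o_def)
  finally show ?thesis by (simp add: assoc)
qed

definition join :: "nat \<Rightarrow> (nat \<Rightarrow> 'a) \<Rightarrow> (nat \<Rightarrow> 'a) \<Rightarrow> nat \<Rightarrow> 'a"
  where "join n x u j = (if j \<le> 2*n then x j else u (j - 2*n))"

text \<open>Meant for \<open>a < b\<close>. In the mixed case the larger index belongs to a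
  \<open>u\<close>, and \<open>Lux\<close> takes the \<open>u\<close> index first, so the arguments
  are exchanged.\<close>

definition join_branches ::
  "nat \<Rightarrow> (nat \<Rightarrow> nat \<Rightarrow> 'a) \<Rightarrow> (nat \<Rightarrow> nat \<Rightarrow> 'a) \<Rightarrow> (nat \<Rightarrow> nat \<Rightarrow> 'a) \<Rightarrow> nat \<Rightarrow> nat \<Rightarrow> 'a"
  where "join_branches n Lux Luu Lxx a b =
    (if b \<le> 2*n then Lxx a b else if a \<le> 2*n then Lux (b - 2*n) a else Luu (a - 2*n) (b - 2*n))"

text \<open>Every exponent in \<open>\<phi>\<close> is \<open>2 / \<kappa>\<close> times the product of the charges of the two points.\<close>

definition charge :: "real \<Rightarrow> nat \<Rightarrow> nat \<Rightarrow> real"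
  where "charge \<kappa> n a = (if a < 2*n then 1 else if a = 2*n then (\<kappa> - 6) / 2 else - 2)"

lemma join_upd_left: "l \<le> 2*n \<Longrightarrow> join n (x(l := z)) u = (join n x u)(l := z)"
  by (auto simp: join_def fun_eq_iff)

lemma join_upd_right: "1 \<le> i \<Longrightarrow> join n x (u(i := z)) = (join n x u)(2*n + i := z)"
  by (auto simp: join_def fun_eq_iff)

text \<open>Splitting both the outer and the inner product at \<open>2*n\<close> separates the five
  kinds of factors; the exponents then agree by comparing products of charges.\<close>

lemma phi_eq_coulomb:
  assumes "\<kappa> > 0" "n \<ge> 1"
  shows "phi \<kappa> n Lux Luu Lxx x u =
    coulomb (3*n) (\<lambda>a b. 2 / \<kappa> * charge \<kappa> n a * charge \<kappa> n b)
      (join_branches n Lux Luu Lxx) (join n x u)" (is "_ = coulomb _ ?p ?L ?y")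
proof -
  let ?f = "\<lambda>b a. bpow (?L a b) (?p a b) (?y b - ?y a)"
  have n3: "3 * n = 2 * n + n" by simp
  have "coulomb (3*n) ?p ?L ?y =
          (\<Prod>b\<in>{1..<2*n}. \<Prod>a\<in>{1..<b}. ?f b a) * (\<Prod>a\<in>{1..<2*n}. ?f (2*n) a) *
          (\<Prod>i\<in>{1..<n}. \<Prod>a\<in>{1..<2*n+i}. ?f (2*n + i) a)"
    unfolding coulomb_def n3 using assms(2) by (intro prod.atLeastLessThan_split_middle) auto
  also have "(\<Prod>b\<in>{1..<2*n}. \<Prod>a\<in>{1..<b}. ?f b a) =
      (\<Prod>b\<in>{1..<2*n}. \<Prod>a\<in>{1..<b}. bpow (Lxx a b) (2 / \<kappa>) (x b - x a))"
    by (intro prod.cong refl) (auto simp: join_def join_branches_def charge_def)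
  also have "(\<Prod>a\<in>{1..<2*n}. ?f (2*n) a) =
      (\<Prod>a\<in>{1..<2*n}. bpow (Lxx a (2*n)) (1 - 6 / \<kappa>) (x (2*n) - x a))"
  proof (intro prod.cong refl)
    fix a assume a: "a \<in> {1..<2*n}"
    have "2 / \<kappa> * ((\<kappa> - 6) / 2) = 1 - 6 / \<kappa>" using assms(1) by (simp add: field_simps)
    then show "?f (2*n) a = bpow (Lxx a (2*n)) (1 - 6 / \<kappa>) (x (2*n) - x a)"
      using a by (simp add: join_def join_branches_def charge_def)
  qed
  also have "(\<Prod>i\<in>{1..<n}. \<Prod>a\<in>{1..<2*n+i}. ?f (2*n + i) a) =
      (\<Prod>i\<in>{1..<n}. (\<Prod>j\<in>{1..<2*n}. bpow (Lux i j) (- 4 / \<kappa>) (u i - x j)) *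
         bpow (Lux i (2*n)) (12 / \<kappa> - 2) (u i - x (2*n)) *
         (\<Prod>i1\<in>{1..<i}. bpow (Luu i1 i) (8 / \<kappa>) (u i - u i1)))"
  proof (intro prod.cong refl)
    fix i assume i: "i \<in> {1..<n}"
    have e: "2 / \<kappa> * ((\<kappa> - 6) / 2) * - 2 = 12 / \<kappa> - 2" using assms(1) by (simp add: field_simps)
    have "(\<Prod>a\<in>{1..<2*n+i}. ?f (2*n + i) a) =
        (\<Prod>a\<in>{1..<2*n}. ?f (2*n + i) a) * ?f (2*n+i) (2*n) * (\<Prod>a\<in>{1..<i}. ?f (2*n + i) (2*n + a))"
      using i assms(2) by (intro prod.atLeastLessThan_split_middle) auto
    also have "(\<Prod>a\<in>{1..<2*n}. ?f (2*n + i) a) = (\<Prod>j\<in>{1..<2*n}. bpow (Lux i j) (- 4 / \<kappa>) (u i - x j))"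
      using i by (intro prod.cong refl) (auto simp: join_def join_branches_def charge_def)
    also have "?f (2*n+i) (2*n) = bpow (Lux i (2*n)) (12 / \<kappa> - 2) (u i - x (2*n))"
      unfolding e[symmetric] using i by (simp add: join_def join_branches_def charge_def)
    also have "(\<Prod>a\<in>{1..<i}. ?f (2*n + i) (2*n + a)) =
        (\<Prod>i1\<in>{1..<i}. bpow (Luu i1 i) (8 / \<kappa>) (u i - u i1))"
      using i by (intro prod.cong refl) (auto simp: join_def join_branches_def charge_def)
    finally show "(\<Prod>a\<in>{1..<2*n+i}. ?f (2*n + i) a) =
        (\<Prod>j\<in>{1..<2*n}. bpow (Lux i j) (- 4 / \<kappa>) (u i - x j)) *
         bpow (Lux i (2*n)) (12 / \<kappa> - 2) (u i - x (2*n)) *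
         (\<Prod>i1\<in>{1..<i}. bpow (Luu i1 i) (8 / \<kappa>) (u i - u i1))" .
  qed
  finally show ?thesis
    unfolding phi_def by (simp add: prod.distrib mult_ac)
qed

lemma partial_partial: "partial k (partial k f) x = deriv (deriv (\<lambda>z. f (x(k := z)))) (x k)"
  by (simp add: partial_def)

section \<open>The operator applied to \<open>phi\<close>\<close>

text \<open>The assumption on branches carries both the choice of powers and the distinctness of all
  points, which is recovered in \<open>inj_y\<close>.\<close>

locale screened_gas =
  fixes \<kappa> :: real and n :: nat and x u :: "nat \<Rightarrow> complex"
    and Lux Luu Lxx :: "nat \<Rightarrow> nat \<Rightarrow> complex \<Rightarrow> complex"
  assumes \<kappa>: "\<kappa> > 0" and n: "n \<ge> 1"
    and branches: "branches (3*n) (join_branches n Lux Luu Lxx) (join n x u)"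
begin

abbreviation "y \<equiv> join n x u"
abbreviation "p \<equiv> \<lambda>a b. 2 / \<kappa> * charge \<kappa> n a * charge \<kappa> n b"
abbreviation "A k \<equiv> logd (3*n) p k y"
abbreviation "K \<equiv> complex_of_real \<kappa>"
abbreviation "\<Phi> \<equiv> phi \<kappa> n Lux Luu Lxx x u"
abbreviation "J \<equiv> {1..<n}"
abbreviation "c a \<equiv> complex_of_real (charge \<kappa> n a)"

lemma K0: "K \<noteq> 0" using \<kappa> by simp

lemma inj_y: "inj_on y {1..<3*n}" using branches by (rule branches_inj_on)

lemma y_x: "l \<le> 2*n \<Longrightarrow> y l = x l" by (simp add: join_def)
lemma y_u: "1 \<le> i \<Longrightarrow> y (2*n + i) = u i" by (simp add: join_def)

lemma u_neq_x: "i \<in> J \<Longrightarrow> j \<in> {1..2*n} \<Longrightarrow> u i \<noteq> x j"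
  using inj_onD[OF inj_y, of "2*n + i" j] by (auto simp: y_x y_u)

lemma u_neq_u: "i \<in> J \<Longrightarrow> j \<in> J \<Longrightarrow> i \<noteq> j \<Longrightarrow> u i \<noteq> u j"
  using inj_onD[OF inj_y, of "2*n + i" "2*n + j"] by (auto simp: y_x y_u)

lemma x_neq_x: "i \<in> {1..2*n} \<Longrightarrow> j \<in> {1..2*n} \<Longrightarrow> i \<noteq> j \<Longrightarrow> x i \<noteq> x j"
  using inj_onD[OF inj_y, of i j] n by (auto simp: y_x y_u)

lemma sum_split_x:
  fixes f :: "nat \<Rightarrow> complex"
  assumes "k \<in> {1..2*n}"
  shows "(\<Sum>a\<in>{1..<3*n}-{k}. f a) = (\<Sum>l\<in>{1..2*n}-{k}. f l) + (\<Sum>i\<in>J. f (2*n + i))"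
proof -
  have "{1..<3*n} - {k} = ({1..2*n} - {k}) \<union> (+) (2*n) ` J"
  proof (intro equalityI subsetI)
    fix a assume a: "a \<in> {1..<3*n} - {k}"
    show "a \<in> ({1..2*n} - {k}) \<union> (+) (2*n) ` J"
    proof (cases "a \<le> 2*n")
      case False
      then have "a = 2*n + (a - 2*n)" "a - 2*n \<in> J" using a by auto
      then show ?thesis by blast
    qed (use a in auto)
  qed (use n assms in auto)
  then have "(\<Sum>a\<in>{1..<3*n}-{k}. f a) = (\<Sum>a\<in>({1..2*n}-{k}) \<union> (+) (2*n) ` J. f a)"
    by (simp only:)
  also have "\<dots> = (\<Sum>l\<in>{1..2*n}-{k}. f l) + (\<Sum>a\<in>(+) (2*n) ` J. f a)"
    by (rule sum.union_disjoint) auto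
  also have "(\<Sum>a\<in>(+) (2*n) ` J. f a) = (\<Sum>i\<in>J. f (2*n + i))"
    by (subst sum.reindex) auto
  finally show ?thesis .
qed

lemma A_u:
  assumes i: "i \<in> J"
  shows "A (2*n + i) = (\<Sum>j\<in>{1..<2*n}. (- 4 / K) / (u i - x j)) + (12 / K - 2) / (u i - x (2*n))
           + (\<Sum>j\<in>J-{i}. (8 / K) / (u i - u j))"
proof -
  let ?f = "\<lambda>a. complex_of_real (p (2*n+i) a) / (y (2*n+i) - y a)"
  have n3: "3 * n = 2 * n + n" by simp
  have m: "2*n + i \<in> {1..<3*n}" using i by auto
  \<comment> \<open>The term \<open>a = 2*n + i\<close> has denominator 0 and so is 0 by the
    convention for division. Including it allows splitting a full interval; it is removed again
    below.\<close>
  have "A (2*n + i) = (\<Sum>a\<in>{1..<3*n}. ?f a)"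
    unfolding logd_def using m by (subst sum.remove[of "{1..<3*n}" "2*n+i"]) auto
  also have "\<dots> = (\<Sum>a\<in>{1..<2*n}. ?f a) + ?f (2*n) + (\<Sum>j\<in>J. ?f (2*n + j))"
    unfolding n3 using n by (intro sum.atLeastLessThan_split_middle) auto
  also have "(\<Sum>a\<in>{1..<2*n}. ?f a) = (\<Sum>j\<in>{1..<2*n}. (- 4 / K) / (u i - x j))"
    using i by (intro sum.cong refl) (auto simp: y_x y_u charge_def)
  also have "?f (2*n) = (12 / K - 2) / (u i - x (2*n))"
  proof -
    have "2 / \<kappa> * - 2 * ((\<kappa> - 6) / 2) = 12 / \<kappa> - 2" using \<kappa> by (simp add: field_simps)
    then have "p (2*n + i) (2*n) = 12 / \<kappa> - 2" using i by (simp add: charge_def)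
    then show ?thesis using i by (simp add: y_x y_u)
  qed
  also have "(\<Sum>j\<in>J. ?f (2*n + j)) = (\<Sum>j\<in>J-{i}. ?f (2*n + j))"
    using i by (subst sum.remove[of J i]) auto
  also have "\<dots> = (\<Sum>j\<in>J-{i}. (8 / K) / (u i - u j))"
    using i by (intro sum.cong refl) (auto simp: y_x y_u charge_def)
  finally show ?thesis .
qed

lemma partial_x_phi:
  assumes "l \<in> {1..2*n}"
  shows "partial l (\<lambda>x. phi \<kappa> n Lux Luu Lxx x u) x = \<Phi> * A l"
proof -
  have "l \<in> {1..<3*n}" using assms n by auto
  then have "((\<lambda>z. phi \<kappa> n Lux Luu Lxx (x(l := z)) u) has_field_derivative \<Phi> * A l) (at (y l))"
    using has_field_derivative_coulomb[OF branches, of l p] assms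
    by (simp add: phi_eq_coulomb[OF \<kappa> n] join_upd_left)
  then show ?thesis using assms by (simp add: partial_def y_x DERIV_imp_deriv)
qed

lemma partial_partial_x_phi:
  assumes "k \<in> {1..2*n}"
  shows "partial k (partial k (\<lambda>x. phi \<kappa> n Lux Luu Lxx x u)) x =
     \<Phi> * ((A k)\<^sup>2 - (\<Sum>a\<in>{1..<3*n}-{k}. of_real (p k a) / (y k - y a)\<^sup>2))"
proof -
  have "k \<in> {1..<3*n}" using assms n by auto
  then show ?thesis
    using deriv_deriv_coulomb[OF branches, of k p] assms
    by (simp add: partial_partial phi_eq_coulomb[OF \<kappa> n] join_upd_left y_x)
qed

text \<open>One product rule for every divergence term: \<open>W\<close> will be
  \<open>2 / (u i - x k)\<close> in (i) and the whole bracket in (ii).\<close>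

lemma partial_u_phi:
  assumes i: "i \<in> J" and W: "((\<lambda>z. W (u(i := z))) has_field_derivative W') (at (u i))"
  shows "partial i (\<lambda>u. W u * phi \<kappa> n Lux Luu Lxx x u) u = \<Phi> * (W' + W u * A (2*n + i))"
proof -
  have "2*n + i \<in> {1..<3*n}" using i by auto
  then have "((\<lambda>z. phi \<kappa> n Lux Luu Lxx x (u(i := z))) has_field_derivative \<Phi> * A (2*n+i)) (at (u i))"
    using has_field_derivative_coulomb[OF branches, of "2*n+i" p] i
    by (simp add: phi_eq_coulomb[OF \<kappa> n] join_upd_right y_u)
  with W have "((\<lambda>z. W (u(i := z)) * phi \<kappa> n Lux Luu Lxx x (u(i := z))) has_field_derivative
      W' * phi \<kappa> n Lux Luu Lxx x (u(i := u i)) + \<Phi> * A (2*n+i) * W (u(i := u i))) (at (u i))"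
    by (rule DERIV_mult)
  then show ?thesis by (simp add: partial_def DERIV_imp_deriv algebra_simps)
qed

text \<open>Common to both identities. The second derivative contributes the square of the field
  with weight \<open>2 / K * (c k)^2\<close>, the symmetrised drift contributes it with weight
  \<open>- 2 / K\<close>, and all else is a sum of inverse squares. The final sum is the part of the
  drift carried by the \<open>u i\<close>, which the divergence supplies.\<close>

lemma Lop_phi:
  assumes k: "k \<in> {1..2*n}"
  shows "Lop \<kappa> n k (\<lambda>x. phi \<kappa> n Lux Luu Lxx x u) x = \<Phi> *
    (2 / K * ((c k)\<^sup>2 - 1) * ((\<Sum>l\<in>{1..2*n}-{k}. c l / (x l - x k)) - 2 * (\<Sum>i\<in>J. 1 / (u i - x k)))\<^sup>2
     + (\<Sum>l\<in>{1..2*n}-{k}. (2 / K * (c l)\<^sup>2 - c k * c l + 4 / K * c k * c l + (K - 6) / K) / (x l - x k)\<^sup>2)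
     + (8 / K + 2 * c k - 8 / K * c k) * (\<Sum>i\<in>J. 1 / (u i - x k)\<^sup>2)
     - (\<Sum>i\<in>J. 2 / (u i - x k) * A (2*n + i)))"
proof -
  define r where "r a = 1 / (y a - y k)" for a
  define I where "I = {1..<3*n} - {k}"
  define S where "S = (\<Sum>a\<in>I. c a * r a)"
  have k': "k \<in> {1..<3*n}" using k n by auto
  have rx: "r l = 1 / (x l - x k)" if "l \<le> 2*n" for l
    using that k by (simp add: r_def y_x)
  have ru: "r (2*n + i) = 1 / (u i - x k)" "c (2*n + i) = - 2" if "i \<in> J" for i
    using that k by (simp_all add: r_def y_x y_u charge_def)
  have Ak: "A k = - (2 / K * (c k * S))"
  proof -
    have "A k = (\<Sum>a\<in>I. - (2 / K * c k) * (c a * r a))"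
      unfolding logd_def I_def
    proof (intro sum.cong refl)
      fix a
      have "r a = - (1 / (y k - y a))" by (simp add: r_def minus_divide_right)
      then show "complex_of_real (p k a) / (y k - y a) = - (2 / K * c k) * (c a * r a)" by simp
    qed
    also have "\<dots> = - (2 / K * (c k * S))" unfolding S_def sum_distrib_left[symmetric] by simp
    finally show ?thesis .
  qed
  have A2: "(\<Sum>a\<in>I. of_real (p k a) / (y k - y a)\<^sup>2) = 2 / K * (c k * (\<Sum>a\<in>I. c a * (r a)\<^sup>2))"
    unfolding sum_distrib_left
    by (intro sum.cong refl) (simp add: r_def power_divide power2_commute)
  have inter: "(\<Sum>a\<in>I. 2 * r a * A a) = 2 / K * (2 * c k * (\<Sum>a\<in>I. c a * (r a)\<^sup>2) - (S\<^sup>2 - (\<Sum>a\<in>I. (c a * r a)\<^sup>2)))"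
    using coulomb_interaction_sum[OF inj_y k', of p "2/\<kappa>" "charge \<kappa> n"]
    unfolding I_def S_def r_def by simp
  \<comment> \<open>The interaction identity needs the drift of all other points, whereas the
    operator only moves the \<open>x l\<close>; the share of the \<open>u i\<close> is therefore
    moved to the other side.\<close>
  have "(\<Sum>a\<in>I. 2 * r a * A a) = (\<Sum>l\<in>{1..2*n}-{k}. 2 / (x l - x k) * A l) + (\<Sum>i\<in>J. 2 / (u i - x k) * A (2*n + i))"
    unfolding I_def sum_split_x[OF k] by (simp add: rx ru)
  then have drift: "(\<Sum>l\<in>{1..2*n}-{k}. 2 / (x l - x k) * A l) =
      2 / K * (2 * c k * (\<Sum>a\<in>I. c a * (r a)\<^sup>2) - (S\<^sup>2 - (\<Sum>a\<in>I. (c a * r a)\<^sup>2))) - (\<Sum>i\<in>J. 2 / (u i - x k) * A (2*n + i))"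
    using inter by (simp add: algebra_simps)
  have "Lop \<kappa> n k (\<lambda>x. phi \<kappa> n Lux Luu Lxx x u) x =
      K / 2 * (\<Phi> * ((A k)\<^sup>2 - (\<Sum>a\<in>I. of_real (p k a) / (y k - y a)\<^sup>2))) +
      (\<Sum>l\<in>{1..2*n}-{k}. 2 / (x l - x k) * (\<Phi> * A l)) +
      (K - 6) / K * (\<Sum>l\<in>{1..2*n}-{k}. 1 / (x l - x k)\<^sup>2) * \<Phi>"
    unfolding Lop_def I_def partial_partial_x_phi[OF k] using partial_x_phi by simp
  also have "(\<Sum>l\<in>{1..2*n}-{k}. 2 / (x l - x k) * (\<Phi> * A l)) = \<Phi> * (\<Sum>l\<in>{1..2*n}-{k}. 2 / (x l - x k) * A l)"
    unfolding sum_distrib_left by (intro sum.cong refl) simp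
  also have "K / 2 * (\<Phi> * ((A k)\<^sup>2 - (\<Sum>a\<in>I. of_real (p k a) / (y k - y a)\<^sup>2))) =
      \<Phi> * (2 / K * ((c k * S)\<^sup>2) - c k * (\<Sum>a\<in>I. c a * (r a)\<^sup>2))"
  proof -
    have "K / 2 * (f * ((- (2 / K * w))\<^sup>2 - 2 / K * v)) = f * (2 / K * w\<^sup>2 - v)" for f w v
      using K0 by (simp add: field_simps power2_eq_square)
    then show ?thesis unfolding Ak A2 .
  qed
  finally have "Lop \<kappa> n k (\<lambda>x. phi \<kappa> n Lux Luu Lxx x u) x = \<Phi> *
      (2 / K * ((c k * S)\<^sup>2) - c k * (\<Sum>a\<in>I. c a * (r a)\<^sup>2) +
       2 / K * (2 * c k * (\<Sum>a\<in>I. c a * (r a)\<^sup>2) - (S\<^sup>2 - (\<Sum>a\<in>I. (c a * r a)\<^sup>2)))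
       - (\<Sum>i\<in>J. 2 / (u i - x k) * A (2*n + i)) +
      (K - 6) / K * (\<Sum>l\<in>{1..2*n}-{k}. 1 / (x l - x k)\<^sup>2))"
    unfolding drift by (simp add: algebra_simps)
  also have "\<dots> = \<Phi> * (2 / K * ((c k)\<^sup>2 - 1) * S\<^sup>2 +
      (2 / K * (\<Sum>a\<in>I. (c a * r a)\<^sup>2) + (4 / K * c k - c k) * (\<Sum>a\<in>I. c a * (r a)\<^sup>2)
       + (K - 6) / K * (\<Sum>l\<in>{1..2*n}-{k}. 1 / (x l - x k)\<^sup>2))
      - (\<Sum>i\<in>J. 2 / (u i - x k) * A (2*n + i)))"
    by (simp add: algebra_simps power_mult_distrib)
  also have "S = (\<Sum>l\<in>{1..2*n}-{k}. c l / (x l - x k)) - 2 * (\<Sum>i\<in>J. 1 / (u i - x k))"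
    unfolding S_def I_def sum_split_x[OF k] by (simp add: rx ru sum_distrib_left sum_negf)
  also have "2 / K * (\<Sum>a\<in>I. (c a * r a)\<^sup>2) + (4 / K * c k - c k) * (\<Sum>a\<in>I. c a * (r a)\<^sup>2)
       + (K - 6) / K * (\<Sum>l\<in>{1..2*n}-{k}. 1 / (x l - x k)\<^sup>2) =
     (\<Sum>l\<in>{1..2*n}-{k}. (2 / K * (c l)\<^sup>2 - c k * c l + 4 / K * c k * c l + (K - 6) / K) / (x l - x k)\<^sup>2)
     + (8 / K + 2 * c k - 8 / K * c k) * (\<Sum>i\<in>J. 1 / (u i - x k)\<^sup>2)"
  proof -
    have 1: "(\<Sum>a\<in>I. (c a * r a)\<^sup>2) = (\<Sum>l\<in>{1..2*n}-{k}. (c l)\<^sup>2 / (x l - x k)\<^sup>2) + 4 * (\<Sum>i\<in>J. 1 / (u i - x k)\<^sup>2)"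
      unfolding I_def sum_split_x[OF k] by (simp add: rx ru power_divide sum_distrib_left)
    have 2: "(\<Sum>a\<in>I. c a * (r a)\<^sup>2) = (\<Sum>l\<in>{1..2*n}-{k}. c l / (x l - x k)\<^sup>2) - 2 * (\<Sum>i\<in>J. 1 / (u i - x k)\<^sup>2)"
      unfolding I_def sum_split_x[OF k] by (simp add: rx ru power_divide sum_distrib_left sum_negf)
    have 3: "(\<Sum>l\<in>{1..2*n}-{k}. (2 / K * (c l)\<^sup>2 - c k * c l + 4 / K * c k * c l + (K - 6) / K) / (x l - x k)\<^sup>2) =
        2 / K * (\<Sum>l\<in>{1..2*n}-{k}. (c l)\<^sup>2 / (x l - x k)\<^sup>2)
        + (4 / K * c k - c k) * (\<Sum>l\<in>{1..2*n}-{k}. c l / (x l - x k)\<^sup>2)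
        + (K - 6) / K * (\<Sum>l\<in>{1..2*n}-{k}. 1 / (x l - x k)\<^sup>2)"
      unfolding sum_distrib_left sum.distrib[symmetric]
      by (intro sum.cong refl) (simp add: add_divide_distrib diff_divide_distrib algebra_simps)
    show ?thesis unfolding 1 2 3 by (simp add: algebra_simps)
  qed
  finally show ?thesis by (simp add: algebra_simps)
qed

section \<open>Identity (i), charge 1\<close>

text \<open>For \<open>c k = 1\<close> the square of the field drops out and the coefficient of
  \<open>1 / (u i - x k)^2\<close> becomes 2, which is matched by the derivative of
  \<open>2 / (u i - x k)\<close>.\<close>

lemma Lop_phi_left:
  assumes k: "k \<in> {1..<2*n}"
  shows "Lop \<kappa> n k (\<lambda>x. phi \<kappa> n Lux Luu Lxx x u) x =
    - (\<Sum>i\<in>J. partial i (\<lambda>u. 2 * phi \<kappa> n Lux Luu Lxx x u / (u i - x k)) u)"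
proof -
  have ck: "c k = 1" using k by (simp add: charge_def)
  have part: "partial i (\<lambda>u. 2 * phi \<kappa> n Lux Luu Lxx x u / (u i - x k)) u =
      \<Phi> * (- 2 / (u i - x k)\<^sup>2 + 2 / (u i - x k) * A (2*n + i))" if i: "i \<in> J" for i
  proof -
    have "u i \<noteq> x k" using u_neq_x[OF i, of k] k by auto
    then have "((\<lambda>z. 2 / ((u(i := z)) i - x k)) has_field_derivative - 2 / (u i - x k)\<^sup>2) (at (u i))"
      by (auto intro!: derivative_eq_intros simp: power2_eq_square)
    from partial_u_phi[OF i this] show ?thesis by simp
  qed
  have "(\<Sum>l\<in>{1..2*n}-{k}. (2 / K * (c l)\<^sup>2 - c k * c l + 4 / K * c k * c l + (K - 6) / K) / (x l - x k)\<^sup>2) = 0"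
    unfolding ck
  proof (intro sum.neutral ballI)
    fix l assume "l \<in> {1..2*n} - {k}"
    \<comment> \<open>The coefficient is a quadratic polynomial in \<open>c l\<close> whose roots
      are precisely these two charges.\<close>
    then have "c l = 1 \<or> c l = (K - 6) / 2" by (auto simp: charge_def)
    then consider "c l = 1" | "c l = (K - 6) / 2" by blast
    then have "2 / K * (c l)\<^sup>2 - 1 * c l + 4 / K * 1 * c l + (K - 6) / K = 0"
    proof cases
      case 1
      show ?thesis unfolding 1 using K0 by (simp add: field_simps)
    next
      case 2
      show ?thesis unfolding 2 using K0 by (simp add: field_simps power2_eq_square)
    qed
    then show "(2 / K * (c l)\<^sup>2 - 1 * c l + 4 / K * 1 * c l + (K - 6) / K) / (x l - x k)\<^sup>2 = 0"
      by simp
  qed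
  then have "Lop \<kappa> n k (\<lambda>x. phi \<kappa> n Lux Luu Lxx x u) x =
      \<Phi> * (2 * (\<Sum>i\<in>J. 1 / (u i - x k)\<^sup>2) - (\<Sum>i\<in>J. 2 / (u i - x k) * A (2*n + i)))"
    using Lop_phi[of k] k ck by simp
  also have "\<dots> = - (\<Sum>i\<in>J. \<Phi> * (- 2 / (u i - x k)\<^sup>2 + 2 / (u i - x k) * A (2*n + i)))"
    unfolding sum_distrib_left[symmetric] sum.distrib by (simp add: sum_distrib_left sum_negf algebra_simps)
  finally show ?thesis using part by simp
qed

section \<open>Identity (ii), the point \<open>x (2*n)\<close>\<close>

text \<open>The second term of the bracket in (ii) without its factor \<open>\<kappa> - 8\<close>.
  After translation by \<open>x (2*n)\<close> it is also the factor in front of the logarithmic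
  derivative in the residues of \<open>residue_identity\<close>.\<close>

definition H :: "nat \<Rightarrow> (nat \<Rightarrow> complex) \<Rightarrow> complex" where
  "H i w = 1 / (w i - x (2*n)) * (\<Prod>j\<in>{1..<2*n}. (w i - x j) / (x (2*n) - x j)) *
     (\<Prod>j\<in>J - {i}. ((x (2*n) - w j) / (w i - w j))\<^sup>2)"

lemma has_field_derivative_H:
  assumes i: "i \<in> J"
  shows "((\<lambda>z. H i (u(i := z))) has_field_derivative
    H i u * (- 1 / (u i - x (2*n)) + (\<Sum>j\<in>{1..<2*n}. 1 / (u i - x j)) + (\<Sum>j\<in>J-{i}. - 2 / (u i - u j)))) (at (u i))"
proof -
  let ?g = "\<lambda>z. 1 / (z - x (2*n)) * (\<Prod>j\<in>{1..<2*n}. (z - x j) / (x (2*n) - x j)) *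
     (\<Prod>j\<in>J - {i}. ((x (2*n) - u j) / (z - u j))\<^sup>2)"
  have 0: "((\<lambda>z. 1 / (z - x (2*n))) has_field_derivative 1 / (u i - x (2*n)) * (- 1 / (u i - x (2*n)))) (at (u i))"
    using u_neq_x[OF i, of "2*n"] n by (auto intro!: derivative_eq_intros simp: divide_simps)
  have 1: "((\<lambda>z. (z - x j) / (x (2*n) - x j)) has_field_derivative
      (u i - x j) / (x (2*n) - x j) * (1 / (u i - x j))) (at (u i))" if "j \<in> {1..<2*n}" for j
  proof -
    have "u i \<noteq> x j" "x (2*n) \<noteq> x j" using u_neq_x[OF i, of j] x_neq_x[of "2*n" j] that by auto
    then show ?thesis by (auto intro!: derivative_eq_intros simp: divide_simps)
  qed
  have 2: "((\<lambda>z. ((x (2*n) - u j) / (z - u j))\<^sup>2) has_field_derivative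
      ((x (2*n) - u j) / (u i - u j))\<^sup>2 * (- 2 / (u i - u j))) (at (u i))" if "j \<in> J - {i}" for j
  proof -
    have "u i - u j \<noteq> 0" using u_neq_u[OF i, of j] that by auto
    then show ?thesis by (auto intro!: derivative_eq_intros simp: power2_eq_square divide_simps)
  qed
  have eq: "(\<lambda>z. H i (u(i := z))) = ?g"
    by (auto simp: H_def fun_eq_iff intro!: arg_cong2[of _ _ _ _ "(*)"] prod.cong)
  have "(?g has_field_derivative ?g (u i) * (- 1 / (u i - x (2*n)) + (\<Sum>j\<in>{1..<2*n}. 1 / (u i - x j)) + (\<Sum>j\<in>J-{i}. - 2 / (u i - u j)))) (at (u i))"
    by (intro has_field_derivative_mult_log has_field_derivative_prod_log 0 1 2)
  then show ?thesis unfolding eq by (simp add: H_def)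
qed

text \<open>Moving \<open>x (2*n)\<close> to the origin turns this into
  \<open>residue_identity\<close>; there are \<open>2*n - 1 = 2 * (n - 1) + 1\<close> points
  \<open>x j\<close> against \<open>n - 1\<close> points \<open>u i\<close>, as the degree condition
  demands.\<close>

lemma sum_H:
  "(\<Sum>i\<in>J. H i u * ((\<Sum>j\<in>{1..<2*n}. 1 / (u i - x j)) - 3 / (u i - x (2*n)) - 2 * (\<Sum>j\<in>J-{i}. 1 / (u i - u j)))) =
    - (((\<Sum>l\<in>{1..<2*n}. 1 / (x l - x (2*n))) - 2 * (\<Sum>i\<in>J. 1 / (u i - x (2*n))))\<^sup>2
        - (\<Sum>l\<in>{1..<2*n}. 1 / (x l - x (2*n))\<^sup>2) + 2 * (\<Sum>i\<in>J. 1 / (u i - x (2*n))\<^sup>2)) / 2"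
proof -
  let ?v = "\<lambda>i. u i - x (2*n)" and ?z = "\<lambda>j. x j - x (2*n)"
  have d1: "?v i - ?z j = u i - x j" "?v i - ?v j = u i - u j" "?z j - ?v i = - (u i - x j)" for i j by auto
  have H: "H i u = 1 / ?v i * (\<Prod>j\<in>{1..<2*n}. (?z j - ?v i) / ?z j) * (\<Prod>j\<in>J-{i}. (?v j / (?v i - ?v j))\<^sup>2)" for i
  proof -
    have a: "(?z j - ?v i) / ?z j = (u i - x j) / (x (2*n) - x j)" for j
      by (metis d1(3) minus_diff_eq minus_divide_divide)
    have b: "(?v j / (?v i - ?v j))\<^sup>2 = ((x (2*n) - u j) / (u i - u j))\<^sup>2" for j
      by (simp add: power_divide power2_commute)
    show ?thesis unfolding H_def a b ..
  qed
  have "inj_on ?v J" using u_neq_u by (fastforce simp: inj_on_def)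
  then have "(\<Sum>i\<in>J. 1 / ?v i * (\<Prod>j\<in>{1..<2*n}. (?z j - ?v i) / ?z j) * (\<Prod>j\<in>J-{i}. (?v j / (?v i - ?v j))\<^sup>2) *
            ((\<Sum>j\<in>{1..<2*n}. 1 / (?v i - ?z j)) - 3 / ?v i - 2 * (\<Sum>j\<in>J-{i}. 1 / (?v i - ?v j)))) =
         - (((\<Sum>j\<in>{1..<2*n}. 1 / ?z j) - 2 * (\<Sum>i\<in>J. 1 / ?v i))\<^sup>2
             - (\<Sum>j\<in>{1..<2*n}. 1 / (?z j)\<^sup>2) + 2 * (\<Sum>i\<in>J. 1 / (?v i)\<^sup>2)) / 2"
    using n u_neq_x x_neq_x by (intro residue_identity) auto
  then show ?thesis by (simp only: H d1(1,2))
qed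

lemma Lop_phi_last:
  "Lop \<kappa> n (2*n) (\<lambda>x. phi \<kappa> n Lux Luu Lxx x u) x =
    - (\<Sum>i\<in>J. partial i (\<lambda>u.
                (2 / (u i - x (2*n)) +
                 of_real (\<kappa> - 8) / (u i - x (2*n)) *
                 (\<Prod>j\<in>{1..<2*n}. (u i - x j) / (x (2*n) - x j)) *
                 (\<Prod>j\<in>J - {i}. ((x (2*n) - u j) / (u i - u j))\<^sup>2)) *
                phi \<kappa> n Lux Luu Lxx x u) u)"
proof -
  \<comment> \<open>\<open>H i u * B i\<close> is the residue at \<open>u i\<close>, by
    \<open>sum_H\<close> and its source.\<close>
  define B where "B i = (\<Sum>j\<in>{1..<2*n}. 1 / (u i - x j)) - 3 / (u i - x (2*n)) - 2 * (\<Sum>j\<in>J-{i}. 1 / (u i - u j))" for i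
  have part: "partial i (\<lambda>u. (2 / (u i - x (2*n)) +
                 of_real (\<kappa> - 8) / (u i - x (2*n)) *
                 (\<Prod>j\<in>{1..<2*n}. (u i - x j) / (x (2*n) - x j)) *
                 (\<Prod>j\<in>J - {i}. ((x (2*n) - u j) / (u i - u j))\<^sup>2)) *
                phi \<kappa> n Lux Luu Lxx x u) u =
     \<Phi> * (- 2 / (u i - x (2*n))\<^sup>2 + 2 / (u i - x (2*n)) * A (2*n + i) + (K - 8) * (K - 4) / K * (H i u * B i))"
    (is "?L = _") if i: "i \<in> J" for i
  proof -
    define W where "W u = 2 / (u i - x (2*n)) + (K - 8) * H i u" for u
    have W: "2 / (u i - x (2*n)) + of_real (\<kappa> - 8) / (u i - x (2*n)) *
                 (\<Prod>j\<in>{1..<2*n}. (u i - x j) / (x (2*n) - x j)) *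
                 (\<Prod>j\<in>J - {i}. ((x (2*n) - u j) / (u i - u j))\<^sup>2) = W u" for u
      by (simp add: W_def H_def)
    let ?D = "- 1 / (u i - x (2*n)) + (\<Sum>j\<in>{1..<2*n}. 1 / (u i - x j)) + (\<Sum>j\<in>J-{i}. - 2 / (u i - u j))"
    have "u i \<noteq> x (2*n)" using u_neq_x[OF i, of "2*n"] n by auto
    then have "((\<lambda>z. 2 / ((u(i := z)) i - x (2*n))) has_field_derivative - 2 / (u i - x (2*n))\<^sup>2) (at (u i))"
      by (auto intro!: derivative_eq_intros simp: power2_eq_square)
    from DERIV_add[OF this DERIV_cmult[OF has_field_derivative_H[OF i]]]
    have "((\<lambda>z. W (u(i := z))) has_field_derivative - 2 / (u i - x (2*n))\<^sup>2 + (K - 8) * (H i u * ?D)) (at (u i))"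
      unfolding W_def .
    from partial_u_phi[OF i this]
    have "partial i (\<lambda>u. W u * phi \<kappa> n Lux Luu Lxx x u) u =
      \<Phi> * (- 2 / (u i - x (2*n))\<^sup>2 + 2 / (u i - x (2*n)) * A (2*n + i) + (K - 8) * (H i u * (?D + A (2*n + i))))"
      unfolding W_def by (simp add: algebra_simps)
    \<comment> \<open>The coefficients \<open>1 - 4 / K\<close>, \<open>12 / K - 3\<close> and
      \<open>8 / K - 2\<close> of the three kinds of terms are all multiples of
      \<open>(K - 4) / K\<close>, so the divergence of \<open>H i u * phi\<close> is proportional to
      the residue.\<close>
    also have "?D + A (2*n + i) = (K - 4) / K * B i"
    proof -
      define a b d where "a = (\<Sum>j\<in>{1..<2*n}. 1 / (u i - x j))" and "b = 1 / (u i - x (2*n))"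
        and "d = (\<Sum>j\<in>J-{i}. 1 / (u i - u j))"
      have s: "(\<Sum>j\<in>{1..<2*n}. (- 4 / K) / (u i - x j)) = - 4 / K * a" "(12 / K - 2) / (u i - x (2*n)) = (12 / K - 2) * b"
        "(\<Sum>j\<in>J-{i}. (8 / K) / (u i - u j)) = 8 / K * d" "(\<Sum>j\<in>J-{i}. - 2 / (u i - u j)) = - 2 * d"
        "- 1 / (u i - x (2*n)) = - b" "3 / (u i - x (2*n)) = 3 * b"
        by (simp_all add: a_def b_def d_def sum_distrib_left)
      show ?thesis
        unfolding A_u[OF i] B_def s a_def[symmetric] d_def[symmetric] using K0 by (simp add: field_simps)
    qed
    also have "(K - 8) * (H i u * ((K - 4) / K * B i)) = (K - 8) * (K - 4) / K * (H i u * B i)"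
      by simp
    finally show ?thesis unfolding W .
  qed
  \<comment> \<open>\<open>M\<close> shields the common factor from being expanded in the last
    rearrangement.\<close>
  define M where "M = (K - 8) * (K - 4) / K"
  define X1 X2 U1 U2 T where
    "X1 = (\<Sum>l\<in>{1..<2*n}. 1 / (x l - x (2*n)))" and "X2 = (\<Sum>l\<in>{1..<2*n}. 1 / (x l - x (2*n))\<^sup>2)"
    and "U1 = (\<Sum>i\<in>J. 1 / (u i - x (2*n)))" and "U2 = (\<Sum>i\<in>J. 1 / (u i - x (2*n))\<^sup>2)"
    and "T = (\<Sum>i\<in>J. 2 / (u i - x (2*n)) * A (2*n + i))"
  have c2n: "c (2*n) = (K - 6) / 2" by (simp add: charge_def)
  have "{1..2*n} - {2*n} = {1..<2*n}" by auto
  moreover have "(\<Sum>l\<in>{1..<2*n}. c l / (x l - x (2*n))) = X1"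
    unfolding X1_def by (intro sum.cong) (auto simp: charge_def)
  moreover have "(\<Sum>l\<in>{1..<2*n}. (2 / K * (c l)\<^sup>2 - c (2*n) * c l + 4 / K * c (2*n) * c l + (K - 6) / K) / (x l - x (2*n))\<^sup>2)
      = - ((K - 8) * (K - 4) / (2 * K)) * X2"
    unfolding X2_def sum_distrib_left
  proof (intro sum.cong refl)
    fix l assume "l \<in> {1..<2*n}"
    then have "c l = 1" by (simp add: charge_def)
    then have "2 / K * (c l)\<^sup>2 - c (2*n) * c l + 4 / K * c (2*n) * c l + (K - 6) / K = - ((K - 8) * (K - 4) / (2 * K))"
      unfolding c2n using K0 by (simp add: field_simps)
    then show "(2 / K * (c l)\<^sup>2 - c (2*n) * c l + 4 / K * c (2*n) * c l + (K - 6) / K) / (x l - x (2*n))\<^sup>2 =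
        - ((K - 8) * (K - 4) / (2 * K)) * (1 / (x l - x (2*n))\<^sup>2)"
      by simp
  qed
  ultimately have "Lop \<kappa> n (2*n) (\<lambda>x. phi \<kappa> n Lux Luu Lxx x u) x =
     \<Phi> * (2 / K * (((K - 6) / 2)\<^sup>2 - 1) * (X1 - 2 * U1)\<^sup>2 + (- ((K - 8) * (K - 4) / (2 * K)) * X2)
        + (8 / K + 2 * ((K - 6) / 2) - 8 / K * ((K - 6) / 2)) * U2 - T)"
    using Lop_phi[of "2*n"] n unfolding U1_def U2_def T_def c2n by simp
  \<comment> \<open>Since \<open>(c (2*n))^2 - 1 = (K - 8) * (K - 4) / 4\<close>, all coefficients
    share this factor except for \<open>2 * U2 - T\<close>, which is the divergence of the first
    term as in (i).\<close>
  also have "\<dots> = \<Phi> * (2 * U2 - T + (K - 8) * (K - 4) / K * (((X1 - 2 * U1)\<^sup>2 - X2 + 2 * U2) / 2))"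
  proof -
    have 1: "2 / K * (((K - 6) / 2)\<^sup>2 - 1) = (K - 8) * (K - 4) / K / 2"
      using K0 by (simp add: field_simps power2_eq_square)
    have 2: "8 / K + 2 * ((K - 6) / 2) - 8 / K * ((K - 6) / 2) = 2 + (K - 8) * (K - 4) / K"
      using K0 by (simp add: field_simps power2_eq_square)
    show ?thesis unfolding 1 2 by (simp add: algebra_simps add_divide_distrib diff_divide_distrib)
  qed
  also have "((X1 - 2 * U1)\<^sup>2 - X2 + 2 * U2) / 2 = - (\<Sum>i\<in>J. H i u * B i)"
    using sum_H unfolding B_def X1_def X2_def U1_def U2_def by simp
  also have "\<Phi> * (2 * U2 - T + (K - 8) * (K - 4) / K * - (\<Sum>i\<in>J. H i u * B i)) =
     - (\<Sum>i\<in>J. \<Phi> * (- 2 / (u i - x (2*n))\<^sup>2 + 2 / (u i - x (2*n)) * A (2*n + i) + (K - 8) * (K - 4) / K * (H i u * B i)))"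
    unfolding U2_def T_def M_def[symmetric] sum_distrib_left[symmetric] sum.distrib
    by (simp add: sum_distrib_left sum_negf algebra_simps)
  finally show ?thesis using part by simp
qed

end

theorem lemma2:
  fixes \<kappa> :: real and n :: nat
    and x u :: "nat \<Rightarrow> complex"
    and Lux Luu Lxx :: "nat \<Rightarrow> nat \<Rightarrow> complex \<Rightarrow> complex"
  assumes "\<kappa> > 0" and "n \<ge> 1"
    and "inj_on x {1..2*n}" and "inj_on u {1..<n}"
    and "x ` {1..2*n} \<inter> u ` {1..<n} = {}"
    and "\<And>i j. \<lbrakk>1 \<le> i; i < n; 1 \<le> j; j \<le> 2*n\<rbrakk> \<Longrightarrow> log_branch_at (u i - x j) (Lux i j)"
    and "\<And>i1 i2. \<lbrakk>1 \<le> i1; i1 < i2; i2 < n\<rbrakk> \<Longrightarrow> log_branch_at (u i2 - u i1) (Luu i1 i2)"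
    and "\<And>j1 j2. \<lbrakk>1 \<le> j1; j1 < j2; j2 \<le> 2*n\<rbrakk> \<Longrightarrow> log_branch_at (x j2 - x j1) (Lxx j1 j2)"
  shows "(\<forall>k\<in>{1..<2*n}.
            Lop \<kappa> n k (\<lambda>x. phi \<kappa> n Lux Luu Lxx x u) x =
            - (\<Sum>i\<in>{1..<n}.
                 partial i (\<lambda>u. 2 * phi \<kappa> n Lux Luu Lxx x u / (u i - x k)) u)) \<and>
         Lop \<kappa> n (2*n) (\<lambda>x. phi \<kappa> n Lux Luu Lxx x u) x =
         - (\<Sum>i\<in>{1..<n}.
              partial i (\<lambda>u.
                (2 / (u i - x (2*n)) +
                 of_real (\<kappa> - 8) / (u i - x (2*n)) *
                 (\<Prod>j\<in>{1..<2*n}. (u i - x j) / (x (2*n) - x j)) *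
                 (\<Prod>j\<in>{1..<n} - {i}. ((x (2*n) - u j) / (u i - u j))\<^sup>2)) *
                phi \<kappa> n Lux Luu Lxx x u) u)"
proof -
  interpret screened_gas \<kappa> n x u Lux Luu Lxx
  proof
    show "branches (3*n) (join_branches n Lux Luu Lxx) (join n x u)"
      unfolding branches_def
    proof (intro ballI)
      fix b a assume ab: "b \<in> {1..<3*n}" "a \<in> {1..<b}"
      \<comment> \<open>As \<open>a < b\<close>, the cases are two \<open>x\<close>, an
        \<open>x\<close> with a \<open>u\<close>, and two \<open>u\<close>.\<close>
      consider "b \<le> 2*n" | "a \<le> 2*n" "2*n < b" | "2*n < a" by linarith
      then show "log_branch_at (join n x u b - join n x u a) (join_branches n Lux Luu Lxx a b)"
        using ab by cases (auto simp: join_def join_branches_def intro!: assms(6-8))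
    qed
  qed (use assms(1,2) in auto)
  show ?thesis using Lop_phi_left Lop_phi_last by blast
qed

end
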